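(* Let $(S,d)$ be a separable metric space, let $\{F_n\}_{n\in\mathbb{N}}$ be a co-base of $S$ which is also a $\pi$-system, and let $X_n$ ($n\in\mathbb{N}$) and $X$ be random elements of $S$ (not necessarily defined on the same probability space). Then the following two statements are equivalent: 1. For every bounded continuous function $f:S\to\mathbb{R}$, $\lim_nEf(X_n)=Ef(X)$. 2. For every $k\in\mathbb{N}$, every rational $\epsilon>0$, and some Urysohn function $U_{k,\epsilon}=U(S\setminus F_k^{\epsilon},F_k)$, $\lim_nEU_{k,\epsilon}(X_n)=EU_{k,\epsilon}(X)$.
   Context: A random element of $S$ is a function from a probability space to $S$ that is measurable with respect to the Borel sigma-algebra of $S$; $E$ denotes expectation with respect to the corresponding probability measure. Co-base: a collection $\{F_j\}_{j\in J}$ of closed subsets of $S$ such that $\{S\setminus F_j\}_{j\in J}$ is a base of the topology of $S$. A $\pi$-system is a collection of sets closed under finite intersections. For $A\subset S$, $A^\epsilon:=\{x\in S:d(x,A)<\epsilon\}$, where $d(x,A)=\inf_{a\in A}d(x,a)$. Urysohn function: given disjoint closed sets $G_0,G_1\subset S$, a Urysohn function $U(G_0,G_1):S\to[0,1]$ is a continuous function with $U^{-1}\{0\}=G_0$ and $U^{-1}\{1\}=G_1$. *)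

theory Defs
  imports "HOL-Probability.Probability"
begin

definition co_base :: "'a::topological_space set set \<Rightarrow> bool" where
  "co_base \<F> \<longleftrightarrow> (\<forall>F\<in>\<F>. closed F) \<and> topological_basis ((\<lambda>F. UNIV - F) ` \<F>)"

(* The infimum is taken in ereal so that d(x, {}) = \<infinity>, and hence {}^\<epsilon> = {}.
   The library's infdist has infdist x {} = 0, which would give {}^\<epsilon> = UNIV instead. *)
definition thickening :: "'a::metric_space set \<Rightarrow> real \<Rightarrow> 'a set" where
  "thickening A \<epsilon> = {x. (INF a\<in>A. ereal (dist x a)) < ereal \<epsilon>}"

(* G0 and G1 are not required to be closed and disjoint: this follows, as they are the
   preimages of {0} and {1} under a continuous function. *)
definition urysohn_function ::
    "'a::topological_space set \<Rightarrow> 'a set \<Rightarrow> ('a \<Rightarrow> real) \<Rightarrow> bool" where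
  "urysohn_function G0 G1 U \<longleftrightarrow>
     continuous_on UNIV U \<and> range U \<subseteq> {0..1} \<and> U -` {0} = G0 \<and> U -` {1} = G1"

definition random_element :: "'b measure \<Rightarrow> ('b \<Rightarrow> 'a::topological_space) \<Rightarrow> bool" where
  "random_element M X \<longleftrightarrow> prob_space M \<and> X \<in> measurable M borel"

end

theory Submission
  imports Defs
begin

text \<open>
  The forward implication only needs a Urysohn function for every pair
  \<open>(UNIV - thickening (F k) \<epsilon>, F k)\<close>, and the distance to \<open>F k\<close> supplies one
  (\<open>urysohn_function_thickening_exists\<close>).

  For the converse, pass to the laws \<open>\<mu> n\<close> of \<open>X n\<close> and \<open>\<nu>\<close> of \<open>Y\<close>. As \<open>\<epsilon>\<close> decreases
  to \<open>0\<close>, the Urysohn functions of a closed set \<open>A\<close> converge pointwise to its indicator, which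
  they dominate. Hence the convergence of their integrals gives
  \<open>limsup (\<mu> n A) \<le> \<nu> A\<close> for every \<open>A\<close> in the co-base
  (\<open>closed_upper_bound_if_urysohn_convergence\<close>).

  An arbitrary open set \<open>G\<close> is the increasing union of finite unions of complements of
  co-base sets, and \<open>\<nu>\<close> of one of these finite unions is already close to \<open>\<nu> G\<close>. By the
  \<open>\<pi>\<close>-system property a nonempty finite union of this kind is again the complement of a
  single co-base set, so the upper bound turns into \<open>liminf (\<mu> n G) \<ge> \<nu> G\<close>
  (\<open>open_lower_bound_if_co_base_upper_bound\<close>).

  This is one of the conditions of the portmanteau theorem. It yields weak convergence by
  writing a continuous function with values in \<open>[0, 1]\<close>, up to a uniform error \<open>1 / m\<close>, as an
  average of indicators of \<open>m\<close> open superlevel sets; this bounds the lower limit of its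
  integrals, and the same bound for \<open>1 - f\<close> controls the upper limit
  (\<open>integral_tendsto_if_open_lower_bound\<close>).

  All semicontinuity bounds are phrased as "every \<open>a\<close> strictly below (above) the limiting
  value is eventually below (above) the values along the filter", which avoids extended reals.
\<close>

section \<open>Urysohn functions of thickenings\<close>

lemma thickening_iff: "x \<in> thickening A \<epsilon> \<longleftrightarrow> (\<exists>a\<in>A. dist x a < \<epsilon>)"
  by (simp add: thickening_def INF_less_iff)

lemma thickening_iff_infdist:
  assumes "A \<noteq> {}"
  shows "x \<in> thickening A \<epsilon> \<longleftrightarrow> infdist x A < \<epsilon>"
  using assms by (auto simp: thickening_iff infdist_def cINF_less_iff)

text \<open>
  The function decreasing linearly from \<open>1\<close> on \<open>A\<close> to \<open>0\<close> at distance \<open>\<epsilon>\<close> works. The empty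
  set is separate because \<open>infdist x {} = 0\<close>, although its thickening is empty.
\<close>

lemma urysohn_function_thickening_exists:
  fixes A :: "'a::metric_space set"
  assumes "closed A" and "\<epsilon> > 0"
  shows "\<exists>U. urysohn_function (UNIV - thickening A \<epsilon>) A U"
proof (cases "A = {}")
  case True
  then have "urysohn_function (UNIV - thickening A \<epsilon>) A (\<lambda>_. 0)"
    by (auto simp: urysohn_function_def thickening_iff)
  then show ?thesis by blast
next
  case False
  define U where "U x = max 0 (1 - infdist x A / \<epsilon>)" for x
  have "U x = 1 \<longleftrightarrow> x \<in> A" for x
    using \<open>\<epsilon> > 0\<close> in_closed_iff_infdist_zero[OF \<open>closed A\<close> False, of x]
    by (auto simp: U_def max_def divide_simps split: if_splits)
  moreover have "U x = 0 \<longleftrightarrow> x \<notin> thickening A \<epsilon>" for x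
    using \<open>\<epsilon> > 0\<close> by (auto simp: U_def max_def divide_simps thickening_iff_infdist[OF False])
  moreover have "U x \<in> {0..1}" for x
    using \<open>\<epsilon> > 0\<close> infdist_nonneg[of x A] by (auto simp: U_def)
  moreover have "continuous_on UNIV U"
    unfolding U_def using \<open>\<epsilon> > 0\<close> by (intro continuous_intros) auto
  ultimately have "urysohn_function (UNIV - thickening A \<epsilon>) A U"
    by (auto simp: urysohn_function_def)
  then show ?thesis by blast
qed

text \<open>
  The intersection of all thickenings of a set is its closure.
\<close>

lemma eventually_notin_thickening:
  assumes "closed A" and "x \<notin> A" and "\<epsilon> \<longlonglongrightarrow> 0"
  shows "\<forall>\<^sub>F j in sequentially. x \<notin> thickening A (\<epsilon> j)"
proof -
  have "open (- A)" and "x \<in> - A"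
    using assms(1,2) by auto
  then obtain e where "e > 0" and e: "ball x e \<subseteq> - A"
    by (rule openE)
  have "\<forall>\<^sub>F j in sequentially. \<epsilon> j < e"
    using order_tendstoD(2)[OF assms(3) \<open>e > 0\<close>] .
  then show ?thesis
  proof eventually_elim
    case (elim j)
    have "\<not> dist x a < \<epsilon> j" if "a \<in> A" for a
    proof
      assume "dist x a < \<epsilon> j"
      with elim have "a \<in> ball x e" by simp
      with e that show False by blast
    qed
    then show ?case by (simp add: thickening_iff)
  qed
qed

section \<open>Upper bounds on closed sets\<close>

text \<open>
  The functions are constantly \<open>1\<close> on \<open>A\<close>, and they vanish eventually at every point outside
  the closed set \<open>A\<close>, so dominated convergence applies.
\<close>

lemma urysohn_integral_tendsto_measure:
  fixes P :: "'a::metric_space measure"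
  assumes "finite_measure P" and sets [measurable_cong]: "sets P = sets borel"
    and "closed A" and "\<epsilon> \<longlonglongrightarrow> 0"
    and U: "\<And>j. urysohn_function (UNIV - thickening A (\<epsilon> j)) A (U j)"
  shows "(\<lambda>j. \<integral>x. U j x \<partial>P) \<longlonglongrightarrow> measure P A"
proof -
  interpret finite_measure P by fact
  have [measurable]: "A \<in> sets borel" using \<open>closed A\<close> by simp
  have [measurable]: "U j \<in> borel_measurable borel" for j
    using U[of j] by (auto simp: urysohn_function_def intro: borel_measurable_continuous_onI)
  have range: "U j x \<in> {0..1}" for j x
    using U[of j] by (simp add: urysohn_function_def image_subset_iff)
  have lim: "(\<lambda>j. U j x) \<longlonglongrightarrow> indicator A x" for x
  proof (cases "x \<in> A")
    case True
    then have "U j x = 1" for j using U[of j] by (auto simp: urysohn_function_def)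
    with True show ?thesis by simp
  next
    case False
    have "\<forall>\<^sub>F j in sequentially. U j x = indicator A x"
      using eventually_notin_thickening[OF \<open>closed A\<close> False \<open>\<epsilon> \<longlonglongrightarrow> 0\<close>]
    proof eventually_elim
      case (elim j)
      then have "x \<in> U j -` {0}" using U[of j] by (simp add: urysohn_function_def)
      with False show ?case by simp
    qed
    then show ?thesis by (rule tendsto_eventually)
  qed
  have "(\<lambda>j. \<integral>x. U j x \<partial>P) \<longlonglongrightarrow> (\<integral>x. indicator A x \<partial>P)"
  proof (rule integral_dominated_convergence[where w = "\<lambda>_. 1"])
    show "AE x in P. (\<lambda>j. U j x) \<longlonglongrightarrow> indicator A x"
      by (simp add: lim)
    show "AE x in P. norm (U j x) \<le> 1" for j
      using range[of j] by simp
  qed simp_all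
  also have "(\<integral>x. indicator A x \<partial>P) = measure P A"
    using sets_eq_imp_space_eq[OF sets] by simp
  finally show ?thesis .
qed

lemma measure_le_urysohn_integral:
  fixes P :: "'a::metric_space measure"
  assumes "finite_measure P" and sets [measurable_cong]: "sets P = sets borel"
    and "closed A" and U: "urysohn_function G A U"
  shows "measure P A \<le> (\<integral>x. U x \<partial>P)"
proof -
  interpret finite_measure P by fact
  have [measurable]: "A \<in> sets borel" using \<open>closed A\<close> by simp
  have [measurable]: "U \<in> borel_measurable borel"
    using U by (auto simp: urysohn_function_def intro: borel_measurable_continuous_onI)
  have range: "U x \<in> {0..1}" for x
    using U by (simp add: urysohn_function_def image_subset_iff)
  have one: "U x = 1" if "x \<in> A" for x
    using U that by (auto simp: urysohn_function_def)
  have "measure P A = (\<integral>x. indicator A x \<partial>P)"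
    using sets_eq_imp_space_eq[OF sets] by simp
  also have "\<dots> \<le> (\<integral>x. U x \<partial>P)"
  proof (rule integral_mono)
    show "integrable P (indicator A :: 'a \<Rightarrow> real)"
      by (rule integrable_const_bound[where B = 1]) auto
    show "integrable P U"
      by (rule integrable_const_bound[where B = 1]) (use range in auto)
    show "indicator A x \<le> U x" for x
      using range[of x] one[of x] by (auto simp: indicator_def)
  qed
  finally show ?thesis .
qed

text \<open>
  Pick a Urysohn function whose \<open>\<nu>\<close>-integral is already below \<open>a\<close>: its \<open>\<mu> i\<close>-integrals are
  eventually below \<open>a\<close> too, and they dominate \<open>\<mu> i A\<close>.
\<close>

lemma closed_upper_bound_if_urysohn_convergence:
  fixes \<mu> :: "'i \<Rightarrow> 'a::metric_space measure"
  assumes "\<And>i. finite_measure (\<mu> i)" and "\<And>i. sets (\<mu> i) = sets borel"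
    and "finite_measure \<nu>" and "sets \<nu> = sets borel"
    and "closed A" and "\<epsilon> \<longlonglongrightarrow> 0"
    and U: "\<And>j. urysohn_function (UNIV - thickening A (\<epsilon> j)) A (U j)"
    and lim: "\<And>j. ((\<lambda>i. \<integral>x. U j x \<partial>\<mu> i) \<longlongrightarrow> (\<integral>x. U j x \<partial>\<nu>)) \<F>"
    and "measure \<nu> A < a"
  shows "\<forall>\<^sub>F i in \<F>. measure (\<mu> i) A < a"
proof -
  have "(\<lambda>j. \<integral>x. U j x \<partial>\<nu>) \<longlonglongrightarrow> measure \<nu> A"
    by (rule urysohn_integral_tendsto_measure) fact+
  then obtain j where "(\<integral>x. U j x \<partial>\<nu>) < a"
    using order_tendstoD(2)[OF _ \<open>measure \<nu> A < a\<close>] eventually_happens trivial_limit_sequentially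
    by metis
  from order_tendstoD(2)[OF lim this] show ?thesis
    by eventually_elim
       (rule le_less_trans[OF measure_le_urysohn_integral[OF assms(1,2,5) U]])
qed

section \<open>Lower bounds on open sets\<close>

lemma Int_stable_INT:
  assumes "Int_stable \<A>" and "finite I" and "I \<noteq> {}" and "\<And>i. i \<in> I \<Longrightarrow> F i \<in> \<A>"
  shows "(\<Inter>i\<in>I. F i) \<in> \<A>"
  using assms(2,3,4) by (induction rule: finite_ne_induct) (auto intro: Int_stableD[OF assms(1)])

text \<open>
  This is where both properties of the family are used. Being a co-base lets finite unions of
  complements exhaust \<open>G\<close>; being a \<open>\<pi>\<close>-system reduces each such union to the complement of
  a single member, on which the upper bound is assumed.
\<close>

lemma open_lower_bound_if_co_base_upper_bound:
  fixes \<mu> :: "'i \<Rightarrow> 'a::topological_space measure" and F :: "nat \<Rightarrow> 'a set"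
  assumes \<mu>: "\<And>i. prob_space (\<mu> i)" "\<And>i. sets (\<mu> i) = sets borel"
    and \<nu>: "prob_space \<nu>" "sets \<nu> = sets borel"
    and co_base: "co_base (range F)" and "Int_stable (range F)"
    and upper: "\<And>k a. measure \<nu> (F k) < a \<Longrightarrow> \<forall>\<^sub>F i in \<F>. measure (\<mu> i) (F k) < a"
    and "open G" and "a < measure \<nu> G"
  shows "\<forall>\<^sub>F i in \<F>. a < measure (\<mu> i) G"
proof -
  interpret \<nu>: prob_space \<nu> by fact
  have closed: "closed (F k)" for k
    using co_base by (simp add: co_base_def)
  have compl: "measure P (- F k) = 1 - measure P (F k)"
    if "prob_space P" "sets P = sets borel" for P k
    using prob_space.prob_compl[OF that(1), of "F k"] that(2) closed[of k]
      sets_eq_imp_space_eq[OF that(2)] by (simp add: Compl_eq_Diff_UNIV)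
  define H where "H m = (\<Union>k\<in>{k. k \<le> m \<and> - F k \<subseteq> G}. - F k)" for m :: nat
  have "open (H m)" for m
    unfolding H_def using closed by (intro open_UN) auto
  then have H_sets: "H m \<in> sets borel" for m by simp
  have "H m \<subseteq> G" for m by (auto simp: H_def)
  have "G = (\<Union>m. H m)"
  proof
    show "G \<subseteq> (\<Union>m. H m)"
    proof
      fix x assume "x \<in> G"
      with co_base \<open>open G\<close> obtain B
        where "B \<in> (\<lambda>F. UNIV - F) ` range F" "x \<in> B" "B \<subseteq> G"
        unfolding co_base_def by (metis topological_basisE)
      then obtain k where "x \<in> - F k" "- F k \<subseteq> G"
        by (auto simp: Compl_eq_Diff_UNIV)
      then show "x \<in> (\<Union>m. H m)" by (auto simp: H_def)
    qed
  qed (use \<open>\<And>m. H m \<subseteq> G\<close> in blast)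
  moreover have "incseq H"
    unfolding incseq_def H_def by (intro allI impI UN_mono) auto
  ultimately have "(\<lambda>m. measure \<nu> (H m)) \<longlonglongrightarrow> measure \<nu> G"
    using \<nu>.finite_Lim_measure_incseq[of H] H_sets \<nu>(2) by auto
  then obtain m where m: "a < measure \<nu> (H m)"
    using order_tendstoD(1)[OF _ \<open>a < measure \<nu> G\<close>] eventually_happens trivial_limit_sequentially
    by metis
  have "\<forall>\<^sub>F i in \<F>. a < measure (\<mu> i) (H m)"
    \<comment> \<open>The empty union need not be the complement of a member of the family. It has measure
      \<open>0\<close> under every measure, so then \<open>a < 0\<close> and the bound is trivial.\<close>
  proof (cases "{k. k \<le> m \<and> - F k \<subseteq> G} = {}")
    case True
    then have "H m = {}" by (simp only: H_def) simp
    with m show ?thesis by simp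
  next
    case False
    then have "(\<Inter>k\<in>{k. k \<le> m \<and> - F k \<subseteq> G}. F k) \<in> range F"
      by (intro Int_stable_INT[OF \<open>Int_stable (range F)\<close>]) auto
    then obtain l where "F l = (\<Inter>k\<in>{k. k \<le> m \<and> - F k \<subseteq> G}. F k)"
      by force
    then have H_eq: "H m = - F l" by (simp add: H_def)
    have "measure \<nu> (F l) < 1 - a"
      using m compl[OF \<nu>, of l] by (simp add: H_eq)
    from upper[OF this] show ?thesis
      by eventually_elim (simp add: H_eq compl[OF \<mu>])
  qed
  then show ?thesis
  proof eventually_elim
    case (elim i)
    interpret prob_space "\<mu> i" by (rule \<mu>)
    have "measure (\<mu> i) (H m) \<le> measure (\<mu> i) G"
      using \<open>H m \<subseteq> G\<close> \<open>open G\<close> \<mu>(2) by (intro finite_measure_mono) auto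
    with elim show ?case by simp
  qed
qed

section \<open>From open sets to bounded continuous functions\<close>

text \<open>
  The number of grid points \<open>i / m\<close> with \<open>1 \<le> i \<le> m\<close> strictly below \<open>y\<close> is
  \<open>\<lceil>m * y\<rceil> - 1\<close>, or \<open>0\<close> if \<open>y = 0\<close>. The inequality is strict so that the superlevel sets
  arising below are open.
\<close>

lemma layer_count_bounds:
  fixes y :: real and m :: nat
  assumes "0 \<le> y" and "y \<le> 1" and "m > 0"
  defines "s \<equiv> (\<Sum>i=1..m. indicator {real i / m <..} y) / m"
  shows "s \<le> y" and "y \<le> s + 1 / m"
proof -
  \<comment> \<open>For \<open>y = 0\<close> the argument of \<open>nat\<close> is \<open>-1\<close>, and truncation gives the count \<open>0\<close>.\<close>
  define c where "c = nat (\<lceil>m * y\<rceil> - 1)"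
  have le_m: "\<lceil>m * y\<rceil> \<le> int m"
    using \<open>y \<le> 1\<close> by (simp add: ceiling_le_iff mult_left_le)
  have "real i / m < y \<longleftrightarrow> int i < \<lceil>m * y\<rceil>" for i
    using \<open>m > 0\<close> by (simp add: less_ceiling_iff field_simps)
  then have "{i \<in> {1..m}. real i / m < y} = {i \<in> {1..m}. int i < \<lceil>m * y\<rceil>}"
    by simp
  also have "\<dots> = {1..c}"
  proof -
    have "{i \<in> {1..m}. int i < z} = {1..nat (z - 1)}" if "z \<le> int m" for z
      using that by auto
    from this[OF le_m] show ?thesis by (simp only: c_def)
  qed
  finally have "(\<Sum>i=1..m. indicator {real i / m <..} y :: real) = c"
    by (simp add: indicator_def sum.If_cases Int_def)
  then have s: "s = c / m" by (simp add: s_def)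
  have "real c \<le> m * y" "m * y \<le> real c + 1"
    using \<open>0 \<le> y\<close> mult_nonneg_nonneg[of "real m" y] unfolding c_def by linarith+
  then show "s \<le> y" "y \<le> s + 1 / m"
    using \<open>m > 0\<close> by (simp_all add: s field_simps)
qed

text \<open>
  A discrete layer-cake formula, obtained by integrating the pointwise bounds.
\<close>

lemma layer_integral_bounds:
  fixes f :: "'a::topological_space \<Rightarrow> real" and m :: nat
  assumes "prob_space P" and sets [measurable_cong]: "sets P = sets borel"
    and "continuous_on UNIV f" and range: "\<And>x. f x \<in> {0..1}" and "m > 0"
  defines "s \<equiv> (\<Sum>i=1..m. measure P {x. real i / m < f x}) / m"
  shows "s \<le> (\<integral>x. f x \<partial>P)" and "(\<integral>x. f x \<partial>P) \<le> s + 1 / m"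
proof -
  interpret prob_space P by fact
  have [measurable]: "f \<in> borel_measurable borel"
    using assms(3) by (rule borel_measurable_continuous_onI)
  define t where "t x = (\<Sum>i=1..m. indicator {real i / m <..} (f x)) / m" for x
  have space: "space P = UNIV"
    using sets_eq_imp_space_eq[OF sets] by simp
  have int_layer: "integrable P (\<lambda>x. indicator {c <..} (f x) :: real)" for c
    by (rule integrable_const_bound[where B = 1]) auto
  then have int_t: "integrable P t"
    unfolding t_def by (intro integrable_divide Bochner_Integration.integrable_sum)
  have "(\<integral>x. indicator {c <..} (f x) \<partial>P) = measure P {x. c < f x}" for c :: real
  proof -
    have "(\<integral>x. indicator {c <..} (f x) \<partial>P) = (\<integral>x. indicat_real {x. c < f x} x \<partial>P)"
      by (rule Bochner_Integration.integral_cong) (auto simp: indicator_def)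
    then show ?thesis by (simp add: space)
  qed
  then have s_eq: "(\<integral>x. t x \<partial>P) = s"
    unfolding t_def s_def by (simp add: Bochner_Integration.integral_sum int_layer)
  have int_f: "integrable P f"
    by (rule integrable_const_bound[where B = 1]) (use range in \<open>auto simp: abs_le_iff\<close>)
  have t: "t x \<le> f x" "f x \<le> t x + 1 / m" for x
    using layer_count_bounds[of "f x" m] range[of x] \<open>m > 0\<close> by (auto simp: t_def)
  show "s \<le> (\<integral>x. f x \<partial>P)"
    unfolding s_eq[symmetric] by (intro integral_mono int_t int_f t)
  have "(\<integral>x. f x \<partial>P) \<le> (\<integral>x. t x + 1 / m \<partial>P)"
    by (intro integral_mono int_f t) (use int_t in auto)
  also have "\<dots> = s + 1 / m"
    using int_t by (simp add: s_eq prob_space)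
  finally show "(\<integral>x. f x \<partial>P) \<le> s + 1 / m" .
qed

text \<open>
  The layer sum involves only finitely many open sets, so the lower bounds on all of them
  eventually hold at once. The gap between \<open>a\<close> and the limit integral is split into two
  halves \<open>\<delta>\<close>: one for the discretisation error \<open>1 / m\<close>, one for the measures of the layers.
\<close>

lemma integral_lower_bound_if_open_lower_bound:
  fixes \<mu> :: "'i \<Rightarrow> 'a::topological_space measure" and f :: "'a \<Rightarrow> real"
  assumes \<mu>: "\<And>i. prob_space (\<mu> i)" "\<And>i. sets (\<mu> i) = sets borel"
    and \<nu>: "prob_space \<nu>" "sets \<nu> = sets borel"
    and lower: "\<And>G a. open G \<Longrightarrow> a < measure \<nu> G \<Longrightarrow> \<forall>\<^sub>F i in \<F>. a < measure (\<mu> i) G"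
    and f: "continuous_on UNIV f" "\<And>x. f x \<in> {0..1}"
    and "a < (\<integral>x. f x \<partial>\<nu>)"
  shows "\<forall>\<^sub>F i in \<F>. a < (\<integral>x. f x \<partial>\<mu> i)"
proof -
  define \<delta> where "\<delta> = ((\<integral>x. f x \<partial>\<nu>) - a) / 2"
  have "\<delta> > 0" using assms by (simp add: \<delta>_def)
  then obtain m :: nat where "m > 0" and m: "1 / m < \<delta>"
    by (metis nat_approx_posE of_nat_Suc zero_less_Suc)
  define G where "G j = {x. real j / m < f x}" for j :: nat
  have "open (G j)" for j
    unfolding G_def by (intro open_Collect_less continuous_intros f)
  then have "\<forall>\<^sub>F i in \<F>. \<forall>j\<in>{1..m}. measure \<nu> (G j) - \<delta> < measure (\<mu> i) (G j)"
    using \<open>\<delta> > 0\<close> by (intro eventually_ball_finite) (auto intro: lower)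
  then show ?thesis
  proof eventually_elim
    case (elim i)
    have "a = (\<integral>x. f x \<partial>\<nu>) - \<delta> - \<delta>" by (simp add: \<delta>_def)
    also have "\<dots> < (\<integral>x. f x \<partial>\<nu>) - 1 / m - \<delta>" using m by simp
    also have "\<dots> \<le> (\<Sum>j=1..m. measure \<nu> (G j)) / m - \<delta>"
      using layer_integral_bounds(2)[OF \<nu> f \<open>m > 0\<close>] by (simp add: G_def)
    also have "\<dots> = (\<Sum>j=1..m. measure \<nu> (G j) - \<delta>) / m"
      using \<open>m > 0\<close> by (simp add: sum_subtractf field_simps)
    also have "\<dots> \<le> (\<Sum>j=1..m. measure (\<mu> i) (G j)) / m"
      by (intro divide_right_mono sum_mono) (use elim in \<open>auto intro: less_imp_le\<close>)
    also have "\<dots> \<le> (\<integral>x. f x \<partial>\<mu> i)"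
      using layer_integral_bounds(1)[OF \<mu> f \<open>m > 0\<close>] by (simp add: G_def)
    finally show ?case .
  qed
qed

text \<open>
  An affine rescaling reduces to a function \<open>g\<close> with values in \<open>[0, 1]\<close>; then \<open>1 - g\<close> is
  of the same kind, and its lower bound is the upper bound for \<open>g\<close>.
\<close>

lemma integral_tendsto_if_open_lower_bound:
  fixes \<mu> :: "'i \<Rightarrow> 'a::topological_space measure" and f :: "'a \<Rightarrow> real"
  assumes \<mu>: "\<And>i. prob_space (\<mu> i)" "\<And>i. sets (\<mu> i) = sets borel"
    and \<nu>: "prob_space \<nu>" "sets \<nu> = sets borel"
    and lower: "\<And>G a. open G \<Longrightarrow> a < measure \<nu> G \<Longrightarrow> \<forall>\<^sub>F i in \<F>. a < measure (\<mu> i) G"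
    and f: "continuous_on UNIV f" and "bounded (range f)"
  shows "((\<lambda>i. \<integral>x. f x \<partial>\<mu> i) \<longlongrightarrow> (\<integral>x. f x \<partial>\<nu>)) \<F>"
proof -
  obtain B where "B > 0" and B: "\<And>x. \<bar>f x\<bar> \<le> B"
    using \<open>bounded (range f)\<close> by (auto simp: bounded_pos)
  define g where "g x = (f x + B) / (2 * B)" for x
  have g: "continuous_on UNIV g" "g x \<in> {0..1}" for x
    using \<open>B > 0\<close> B[of x] by (auto simp: g_def abs_le_iff intro!: continuous_intros f)
  have g': "continuous_on UNIV (\<lambda>x. 1 - g x)" "1 - g x \<in> {0..1}" for x
    using g by (auto intro!: continuous_intros)
  have int_g: "integrable P g" if P: "prob_space P" "sets P = sets borel" for P
  proof -
    interpret prob_space P by fact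
    show ?thesis
      by (rule integrable_const_bound[where B = 1])
         (use g borel_measurable_continuous_onI[OF g(1)] in \<open>auto simp: abs_le_iff measurable_cong_sets[OF P(2) refl]\<close>)
  qed
  have compl: "(\<integral>x. 1 - g x \<partial>P) = 1 - (\<integral>x. g x \<partial>P)"
    and f_eq: "(\<integral>x. f x \<partial>P) = 2 * B * (\<integral>x. g x \<partial>P) - B"
    if P: "prob_space P" "sets P = sets borel" for P
  proof -
    interpret prob_space P by fact
    show "(\<integral>x. 1 - g x \<partial>P) = 1 - (\<integral>x. g x \<partial>P)"
      using int_g[OF P] by (simp add: prob_space)
    have "f = (\<lambda>x. 2 * B * g x - B)"
      using \<open>B > 0\<close> by (auto simp: g_def)
    then show "(\<integral>x. f x \<partial>P) = 2 * B * (\<integral>x. g x \<partial>P) - B"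
      using int_g[OF P] by (simp add: prob_space)
  qed
  have "((\<lambda>i. \<integral>x. g x \<partial>\<mu> i) \<longlongrightarrow> (\<integral>x. g x \<partial>\<nu>)) \<F>"
  proof (rule order_tendstoI)
    show "\<forall>\<^sub>F i in \<F>. a < (\<integral>x. g x \<partial>\<mu> i)" if "a < (\<integral>x. g x \<partial>\<nu>)" for a
      by (rule integral_lower_bound_if_open_lower_bound[OF \<mu> \<nu> lower g that])
    show "\<forall>\<^sub>F i in \<F>. (\<integral>x. g x \<partial>\<mu> i) < a" if "(\<integral>x. g x \<partial>\<nu>) < a" for a
      using integral_lower_bound_if_open_lower_bound[OF \<mu> \<nu> lower g', where a = "1 - a"] that
      by (simp add: compl \<mu> \<nu>)
  qed
  then show ?thesis
    unfolding f_eq[OF \<mu>] f_eq[OF \<nu>] by (intro tendsto_intros)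
qed

theorem theorem2p6p1:
  fixes F :: "nat \<Rightarrow> 'a::metric_space set"
    and M :: "nat \<Rightarrow> 'b measure" and X :: "nat \<Rightarrow> 'b \<Rightarrow> 'a"
    and N :: "'c measure" and Y :: "'c \<Rightarrow> 'a"
  assumes "separable_space (euclidean :: 'a topology)"
    and "co_base (range F)"
    and "Int_stable (range F)"
    and "\<And>n. random_element (M n) (X n)"
    and "random_element N Y"
  shows "(\<forall>f :: 'a \<Rightarrow> real. continuous_on UNIV f \<and> bounded (range f) \<longrightarrow>
            (\<lambda>n. \<integral>\<omega>. f (X n \<omega>) \<partial>(M n)) \<longlonglongrightarrow> (\<integral>\<omega>. f (Y \<omega>) \<partial>N))
     \<longleftrightarrow> (\<forall>k. \<forall>\<epsilon>\<in>\<rat>. \<epsilon> > 0 \<longrightarrow>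
            (\<exists>U. urysohn_function (UNIV - thickening (F k) \<epsilon>) (F k) U \<and>
              (\<lambda>n. \<integral>\<omega>. U (X n \<omega>) \<partial>(M n)) \<longlonglongrightarrow> (\<integral>\<omega>. U (Y \<omega>) \<partial>N)))"
    (is "?weak \<longleftrightarrow> ?urysohn")
proof
  have closed: "closed (F k)" for k
    using \<open>co_base (range F)\<close> by (simp add: co_base_def)
  {
    assume weak: ?weak
    show ?urysohn
    proof (intro allI ballI impI)
      fix k and \<epsilon> :: real assume "\<epsilon> > 0"
      from urysohn_function_thickening_exists[OF closed this]
      obtain U where U: "urysohn_function (UNIV - thickening (F k) \<epsilon>) (F k) U" ..
      then have "continuous_on UNIV U" and "bounded (range U)"
        by (auto simp: urysohn_function_def intro: bounded_subset[OF bounded_closed_interval])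
      with weak U show "\<exists>U. urysohn_function (UNIV - thickening (F k) \<epsilon>) (F k) U \<and>
          (\<lambda>n. \<integral>\<omega>. U (X n \<omega>) \<partial>(M n)) \<longlonglongrightarrow> (\<integral>\<omega>. U (Y \<omega>) \<partial>N)"
        by blast
    qed
  next
    assume urysohn: ?urysohn
    define \<mu> where "\<mu> n = distr (M n) borel (X n)" for n
    define \<nu> where "\<nu> = distr N borel Y"
    have X [measurable]: "X n \<in> borel_measurable (M n)" and Y [measurable]: "Y \<in> borel_measurable N" for n
      using assms(4,5) by (auto simp: random_element_def)
    have \<mu>: "prob_space (\<mu> n)" "sets (\<mu> n) = sets borel" for n
      using assms(4) by (auto simp: \<mu>_def random_element_def intro: prob_space.prob_space_distr)
    have \<nu>: "prob_space \<nu>" "sets \<nu> = sets borel"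
      using assms(5) by (auto simp: \<nu>_def random_element_def intro: prob_space.prob_space_distr)
    have integral_X: "(\<integral>\<omega>. f (X n \<omega>) \<partial>M n) = (\<integral>x. f x \<partial>\<mu> n)"
      and integral_Y: "(\<integral>\<omega>. f (Y \<omega>) \<partial>N) = (\<integral>x. f x \<partial>\<nu>)"
      if "continuous_on UNIV f" for f :: "'a \<Rightarrow> real" and n
      using borel_measurable_continuous_onI[OF that]
      by (simp_all add: \<mu>_def \<nu>_def integral_distr)
    define \<epsilon> where "\<epsilon> j = 1 / real (Suc j)" for j
    have "\<epsilon> \<longlonglongrightarrow> 0"
      unfolding \<epsilon>_def by (rule LIMSEQ_Suc[OF lim_1_over_n])
    have upper: "\<forall>\<^sub>F n in sequentially. measure (\<mu> n) (F k) < a" if "measure \<nu> (F k) < a" for k a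
    proof -
      have "\<epsilon> j \<in> \<rat>" "\<epsilon> j > 0" for j by (auto simp: \<epsilon>_def)
      with urysohn have "\<forall>j. \<exists>U. urysohn_function (UNIV - thickening (F k) (\<epsilon> j)) (F k) U \<and>
          (\<lambda>n. \<integral>\<omega>. U (X n \<omega>) \<partial>(M n)) \<longlonglongrightarrow> (\<integral>\<omega>. U (Y \<omega>) \<partial>N)"
        by blast
      then obtain U where U: "\<And>j. urysohn_function (UNIV - thickening (F k) (\<epsilon> j)) (F k) (U j)"
        and lim: "\<And>j. (\<lambda>n. \<integral>\<omega>. U j (X n \<omega>) \<partial>(M n)) \<longlonglongrightarrow> (\<integral>\<omega>. U j (Y \<omega>) \<partial>N)"
        by metis
      have "continuous_on UNIV (U j)" for j
        using U[of j] by (simp add: urysohn_function_def)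
      with lim have "(\<lambda>n. \<integral>x. U j x \<partial>\<mu> n) \<longlonglongrightarrow> (\<integral>x. U j x \<partial>\<nu>)" for j
        by (simp add: integral_X integral_Y)
      with \<mu> \<nu> U closed \<open>\<epsilon> \<longlonglongrightarrow> 0\<close> that show ?thesis
        by (intro closed_upper_bound_if_urysohn_convergence[of \<mu> \<nu> "F k" \<epsilon> U])
           (auto simp: prob_space.finite_measure)
    qed
    have lower: "\<forall>\<^sub>F n in sequentially. a < measure (\<mu> n) G" if "open G" "a < measure \<nu> G" for G a
      by (rule open_lower_bound_if_co_base_upper_bound[OF \<mu> \<nu> assms(2,3) upper that])
    show ?weak
    proof (intro allI impI, elim conjE)
      fix f :: "'a \<Rightarrow> real" assume f: "continuous_on UNIV f" "bounded (range f)"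
      show "(\<lambda>n. \<integral>\<omega>. f (X n \<omega>) \<partial>(M n)) \<longlonglongrightarrow> (\<integral>\<omega>. f (Y \<omega>) \<partial>N)"
        using integral_tendsto_if_open_lower_bound[OF \<mu> \<nu> lower f]
        by (simp add: integral_X integral_Y f(1))
    qed
  }
qed

end
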